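(* The quasi-order of embeddability between countable LD-monoids is invariantly universal: for every analytic quasi-order $R$ on a standard Borel space there is a Borel subset $B$ of the standard Borel space of LD-monoids with underlying set $\mathbb{N}$, closed under isomorphism, such that the embeddability relation restricted to $B$ is Borel bi-reducible with $R$.
   Context: An LD-monoid is a structure $(M,\circ,\ast)$ with two binary operations satisfying, for all $a,b,c$: $a\circ(b\circ c)=(a\circ b)\circ c$; $(a\circ b)\ast c=a\ast(b\ast c)$; $a\ast(b\circ c)=(a\ast b)\circ(a\ast c)$; $(a\ast b)\circ a=a\circ b$. The space of LD-monoids on $\mathbb{N}$ is the set of pairs of such operations on $\mathbb{N}$, a Borel subset of $2^{\mathbb{N}^3}\times 2^{\mathbb{N}^3}$ with the induced standard Borel structure. An embedding is an injective map preserving both operations. Borel bi-reducibility of quasi-orders $P$ on $X$ and $R$ on $Y$: there are Borel $f\colon X\to Y$ and $g\colon Y\to X$ with $x\mathrel{P}x'\iff f(x)\mathrel{R}f(x')$ and $y\mathrel{R}y'\iff g(y)\mathrel{P}g(y')$. *)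

theory Defs
  imports "HOL-Analysis.Analysis"
begin

text \<open>Measurable spaces are represented by \<^typ>\<open>'a measure\<close>; only \<^const>\<open>space\<close> and
  \<^const>\<open>sets\<close> play a role, the measure itself is irrelevant.\<close>

definition standard_borel :: "'a measure \<Rightarrow> bool" where
  "standard_borel M \<longleftrightarrow>
     (\<exists>T. completely_metrizable_space T \<and> second_countable T \<and>
          space M = topspace T \<and> sets M = sigma_sets (topspace T) {U. openin T U})"

text \<open>A set is analytic if it is the image of a standard Borel space under a Borel map. Since HOL
  cannot quantify over types, the domain is a standard Borel space whose points
  lie in \<^typ>\<open>nat \<Rightarrow> nat\<close>; up to Borel isomorphism these are all standard Borel spaces. The domain
  may be empty, so the empty set is analytic.\<close>

definition analytic_in :: "'a measure \<Rightarrow> 'a set \<Rightarrow> bool" where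
  "analytic_in M A \<longleftrightarrow>
     (\<exists>(N :: (nat \<Rightarrow> nat) measure) f. standard_borel N \<and> f \<in> N \<rightarrow>\<^sub>M M \<and> A = f ` space N)"

definition analytic_quasi_order :: "'a measure \<Rightarrow> 'a rel \<Rightarrow> bool" where
  "analytic_quasi_order M R \<longleftrightarrow> preorder_on (space M) R \<and> analytic_in (M \<Otimes>\<^sub>M M) R"

text \<open>In both definitions below, only the values of the relations on the points of the given spaces
  matter.\<close>

definition borel_reducible :: "'a measure \<Rightarrow> 'a rel \<Rightarrow> 'b measure \<Rightarrow> 'b rel \<Rightarrow> bool" where
  "borel_reducible M P N R \<longleftrightarrow>
     (\<exists>f \<in> M \<rightarrow>\<^sub>M N. \<forall>x \<in> space M. \<forall>x' \<in> space M. (x, x') \<in> P \<longleftrightarrow> (f x, f x') \<in> R)"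

definition borel_bireducible :: "'a measure \<Rightarrow> 'a rel \<Rightarrow> 'b measure \<Rightarrow> 'b rel \<Rightarrow> bool" where
  "borel_bireducible M P N R \<longleftrightarrow> borel_reducible M P N R \<and> borel_reducible N R M P"

type_synonym 'a two_ops = "('a \<Rightarrow> 'a \<Rightarrow> 'a) \<times> ('a \<Rightarrow> 'a \<Rightarrow> 'a)"

definition LD_monoid :: "'a two_ops \<Rightarrow> bool" where
  "LD_monoid = (\<lambda>(comp, star).
     (\<forall>a b c. comp a (comp b c) = comp (comp a b) c) \<and>
     (\<forall>a b c. star (comp a b) c = star a (star b c)) \<and>
     (\<forall>a b c. star a (comp b c) = comp (star a b) (star a c)) \<and>
     (\<forall>a b. comp (star a b) a = comp a b))"

definition two_ops_hom :: "('a \<Rightarrow> 'b) \<Rightarrow> 'a two_ops \<Rightarrow> 'b two_ops \<Rightarrow> bool" where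
  "two_ops_hom h S T \<longleftrightarrow>
     (\<forall>a b. h (fst S a b) = fst T (h a) (h b)) \<and>
     (\<forall>a b. h (snd S a b) = snd T (h a) (h b))"

definition embeddability :: "'a two_ops rel" where
  "embeddability = {(S, T). \<exists>h. inj h \<and> two_ops_hom h S T}"

definition isomorphic_ops :: "'a two_ops \<Rightarrow> 'a two_ops \<Rightarrow> bool" where
  "isomorphic_ops S T \<longleftrightarrow> (\<exists>h. bij h \<and> two_ops_hom h S T)"

text \<open>The characteristic function of the graph of an operation, a point of $2^{N^3}$; the type
  \<^typ>\<open>nat \<times> nat \<times> nat \<Rightarrow> bool\<close> carries the product topology with \<^typ>\<open>bool\<close> discrete.\<close>

definition op_graph :: "(nat \<Rightarrow> nat \<Rightarrow> nat) \<Rightarrow> (nat \<times> nat \<times> nat \<Rightarrow> bool)" where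
  "op_graph f = (\<lambda>(a, b, c). f a b = c)"

text \<open>The set of LD-monoids on the natural numbers, with the Borel structure induced from
  $2^{N^3} \times 2^{N^3}$ by identifying each operation with its graph.\<close>

definition LD_monoid_space :: "nat two_ops measure" where
  "LD_monoid_space =
     vimage_algebra {S. LD_monoid S} (\<lambda>(comp, star). (op_graph comp, op_graph star)) borel"

definition isomorphism_closed :: "nat two_ops set \<Rightarrow> bool" where
  "isomorphism_closed B \<longleftrightarrow>
     (\<forall>S \<in> B. \<forall>T \<in> space LD_monoid_space. isomorphic_ops S T \<longrightarrow> T \<in> B)"

end

theory Submission
  imports Defs
begin

text \<open>The LD-monoids are chosen with constant composition. Then every map may occur as right
  multiplication by a constant \<open>Fn k\<close>, so that LD-monoids encode unary algebras with countably many
  named, non-commuting operations. Code the points of the given space by sequences of natural numbers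
  and write \<open>R\<close> as the set of all \<open>(x, y)\<close> for which some \<open>\<alpha>\<close> satisfies \<open>T (x|n) (y|n) (\<alpha>|n)\<close> for
  all \<open>n\<close>.

  The algebra of \<open>x\<close> is a Yoneda embedding: its elements are the level-\<open>n\<close> approximations of chains
  \<open>v\<^sub>0 R v\<^sub>1 R \<dots> R x\<close> together with witnesses of the links. The operations truncate a chain to the level
  below, prepend a link, and test that the chain is correct and starts at a given sequence. If \<open>\<alpha>\<close>
  witnesses \<open>x R y\<close>, appending the link \<open>(x|n, \<alpha>|n)\<close> is an embedding. Conversely, an embedding sends
  the empty chains at \<open>x\<close> to a coherent sequence of correct chains from \<open>x\<close> to \<open>y\<close>, whose limit gives
  \<open>x R y\<close> by transitivity.

  Prepending generates the algebra from the empty chains, and these are not in the image of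
  prepending. So an isomorphism determines every element by a Borel condition, and the set of
  isomorphic copies is Borel.\<close>

subsection \<open>Sequences of natural numbers and their finite prefixes\<close>

definition pre :: "(nat \<Rightarrow> nat) \<Rightarrow> nat \<Rightarrow> nat list" where
  "pre x n = map x [0..<n]"

lemma length_pre [simp]: "length (pre x n) = n"
  by (simp add: pre_def)

lemma pre_eq_iff: "pre x n = pre y n \<longleftrightarrow> (\<forall>i<n. x i = y i)"
  by (auto simp: pre_def)

lemma take_pre: "m \<le> n \<Longrightarrow> take m (pre x n) = pre x m"
  by (simp add: pre_def take_map min_def)

lemma pre_inject: "(\<forall>n. pre x n = pre y n) \<longleftrightarrow> x = y"
  by (metis ext lessI pre_eq_iff)

lemma coherent_prefixes:
  assumes len: "\<And>n. length (l n) = n" and coh: "\<And>n. l n = take n (l (Suc n))"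
  obtains z where "\<And>n. l n = pre z n"
proof
  \<comment> \<open>Entry \<open>i\<close> is read off \<open>l (Suc i)\<close>, the first list that
    is long enough to have one.\<close>
  fix n show "l n = pre (\<lambda>i. l (Suc i) ! i) n"
  proof (induction n)
    case 0
    then show ?case using len[of 0] by (simp add: pre_def)
  next
    case (Suc n)
    have "l (Suc n) = take n (l (Suc n)) @ [l (Suc n) ! n]"
      using len[of "Suc n"] by (metis lessI take_Suc_conv_app_nth take_all_iff order_refl)
    then show ?case using Suc coh[of n] by (simp add: pre_def)
  qed
qed

lemma measurable_pre [measurable]: "(\<lambda>x. pre x n) \<in> borel \<rightarrow>\<^sub>M count_space UNIV"
proof (induction n)
  case 0
  then show ?case by (simp add: pre_def)
next
  case (Suc n)
  have c: "(\<lambda>x::nat\<Rightarrow>nat. x n) \<in> borel \<rightarrow>\<^sub>M count_space UNIV"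
  proof -
    have "(\<lambda>x::nat\<Rightarrow>nat. x n) \<in> borel \<rightarrow>\<^sub>M borel"
      by (rule measurable_product_then_coordinatewise) simp
    then show ?thesis by (simp add: measurable_cong_sets[OF refl sets_borel_eq_count_space])
  qed
  have "(\<lambda>x. (\<lambda>l a. l @ [a]) (pre x n) (x n)) \<in> borel \<rightarrow>\<^sub>M count_space UNIV"
    using Suc c by measurable
  then show ?case by (simp add: pre_def)
qed

lemma measurable_into_baire:
  fixes f :: "'a \<Rightarrow> nat \<Rightarrow> nat"
  assumes "\<And>n. (\<lambda>x. f x n) \<in> M \<rightarrow>\<^sub>M count_space UNIV"
  shows "f \<in> M \<rightarrow>\<^sub>M borel"
  using assms measurable_cong_sets[OF refl sets_borel_eq_count_space, of M]
  by (intro measurable_coordinatewise_then_product) auto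

lemma measurable_coordinate:
  assumes "f \<in> M \<rightarrow>\<^sub>M (borel :: (nat \<Rightarrow> nat) measure)"
  shows "(\<lambda>x. f x n) \<in> M \<rightarrow>\<^sub>M count_space UNIV"
  using measurable_product_then_coordinatewise[OF assms, of n]
  by (simp add: measurable_cong_sets[OF refl sets_borel_eq_count_space])

lemma pred_eq_baire:
  assumes "f \<in> M \<rightarrow>\<^sub>M (borel :: (nat \<Rightarrow> nat) measure)" "g \<in> M \<rightarrow>\<^sub>M borel"
  shows "Measurable.pred M (\<lambda>x. f x = g x)"
proof -
  note [measurable] = measurable_coordinate[OF assms(1)] measurable_coordinate[OF assms(2)]
  \<comment> \<open>Comparing both sides with a constant \<open>k\<close> reduces equality to
    countably many preimages of points.\<close>
  have "Measurable.pred M (\<lambda>x. \<forall>n. \<exists>k. f x n = k \<and> g x n = k)"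
    by measurable
  moreover have "(f x = g x) = (\<forall>n. \<exists>k. f x n = k \<and> g x n = k)" for x
    by auto
  ultimately show ?thesis by simp
qed

text \<open>Triples in \<open>F\<close> chosen with longer and longer common prefixes converge to
  \<open>(x, y, z)\<close>, as every coordinate is eventually constant.\<close>

lemma closed_if_agree_on_prefixes:
  fixes F :: "((nat \<Rightarrow> nat) \<times> (nat \<Rightarrow> nat) \<times> (nat \<Rightarrow> nat)) set"
  assumes F: "closed F"
    and agree: "\<And>n. \<exists>(x', y', z') \<in> F. pre x' n = pre x n \<and> pre y' n = pre y n \<and> pre z' n = pre z n"
  shows "(x, y, z) \<in> F"
proof -
  have lim: "f \<longlonglongrightarrow> w" if f: "\<And>n. pre (f n) n = pre w n" for f :: "nat \<Rightarrow> nat \<Rightarrow> nat" and w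
  proof -
    have "(\<lambda>n. f n i) \<longlonglongrightarrow> w i" for i
    proof (rule tendsto_eventually)
      show "\<forall>\<^sub>F n in sequentially. f n i = w i"
        using eventually_gt_at_top[of i]
      proof (rule eventually_mono)
        fix n assume "i < n"
        then show "f n i = w i"
          using f[of n] by (simp only: pre_eq_iff)
      qed
    qed
    then have "limitin (product_topology (\<lambda>_. euclidean) UNIV) f w sequentially"
      by (simp add: limitin_componentwise)
    then show ?thesis
      by (simp only: euclidean_product_topology limitin_canonical_iff)
  qed
  define good where "good n p \<longleftrightarrow> p \<in> F \<and> pre (fst p) n = pre x n \<and> pre (fst (snd p)) n = pre y n \<and>
     pre (snd (snd p)) n = pre z n" for n p
  have "\<exists>p. good n p" for n
    using agree[of n] by (auto simp: good_def)
  then obtain p where "\<And>n. good n (p n)"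
    by metis
  then have p: "\<And>n. p n \<in> F" "\<And>n. pre (fst (p n)) n = pre x n"
    "\<And>n. pre (fst (snd (p n))) n = pre y n" "\<And>n. pre (snd (snd (p n))) n = pre z n"
    by (simp_all add: good_def)
  have "(\<lambda>n. (fst (p n), fst (snd (p n)), snd (snd (p n)))) \<longlonglongrightarrow> (x, y, z)"
    using lim[of "\<lambda>n. fst (p n)" x, OF p(2)] lim[of "\<lambda>n. fst (snd (p n))" y, OF p(3)]
      lim[of "\<lambda>n. snd (snd (p n))" z, OF p(4)]
    by (simp only: tendsto_Pair)
  then have "p \<longlonglongrightarrow> (x, y, z)"
    by (simp only: prod.collapse)
  with F p(1) show ?thesis
    by (rule closed_sequentially)
qed

subsection \<open>Projections of closed sets\<close>

text \<open>In Polish spaces this is a classical normal form of analytic sets. The closed set is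
  what later yields a tree.\<close>

definition souslin :: "'z::topological_space set \<Rightarrow> bool" where
  "souslin A \<longleftrightarrow> (\<exists>F :: ('z \<times> (nat \<Rightarrow> nat)) set. closed F \<and> A = fst ` F)"

lemma souslinE:
  assumes "souslin A"
  obtains F where "closed F" "\<And>z. z \<in> A \<longleftrightarrow> (\<exists>\<beta>::nat \<Rightarrow> nat. (z, \<beta>) \<in> F)"
  using assms unfolding souslin_def by force

lemma souslinI:
  assumes "closed F" "\<And>z. z \<in> A \<longleftrightarrow> (\<exists>\<beta>::nat \<Rightarrow> nat. (z, \<beta>) \<in> F)"
  shows "souslin A"
  using assms unfolding souslin_def by force

text \<open>The map \<open>j\<close> selects the coordinates that carry one of the witnesses packed
  into a single sequence.\<close>

lemma continuous_on_reindex: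
  "continuous_on S (\<lambda>w::'z::topological_space \<times> (nat \<Rightarrow> nat). (fst w, \<lambda>n. snd w (j n)))"
proof -
  have "continuous_on S (\<lambda>w::'z \<times> (nat \<Rightarrow> nat). snd w (j n))" for n
    by (rule continuous_on_product_then_coordinatewise) (intro continuous_on_snd continuous_on_id)
  then show ?thesis
    by (intro continuous_on_Pair continuous_on_fst continuous_on_id
        continuous_on_coordinatewise_then_product)
qed

lemma souslin_closed: "closed A \<Longrightarrow> souslin A"
  by (rule souslinI[of "A \<times> UNIV"]) (auto intro: closed_Times)

text \<open>A single sequence holds a witness for each \<open>A i\<close>: the \<open>i\<close>-th
  one sits at the places \<open>prod_encode (i, n)\<close>.\<close>

lemma souslin_INT:
  assumes "\<And>i::nat. souslin (A i)"
  shows "souslin (\<Inter>i. A i)"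
proof -
  have "\<forall>i. \<exists>F. closed F \<and> (\<forall>z. z \<in> A i \<longleftrightarrow> (\<exists>\<beta>::nat \<Rightarrow> nat. (z, \<beta>) \<in> F))"
    using assms by (meson souslinE)
  then obtain F where F: "\<And>i. closed (F i)" "\<And>i z. z \<in> A i \<longleftrightarrow> (\<exists>\<beta>::nat \<Rightarrow> nat. (z, \<beta>) \<in> F i)"
    by metis
  let ?G = "\<Inter>i. (\<lambda>w. (fst w, \<lambda>n. snd w (prod_encode (i, n)))) -` F i"
  show ?thesis
  proof (rule souslinI)
    show "closed ?G"
      by (intro closed_INT ballI closed_vimage F continuous_on_reindex)
    fix z
    show "z \<in> (\<Inter>i. A i) \<longleftrightarrow> (\<exists>\<beta>. (z, \<beta>) \<in> ?G)"
    proof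
      assume "z \<in> (\<Inter>i. A i)"
      then obtain \<beta> where \<beta>: "\<And>i. (z, \<beta> i) \<in> F i"
        using F(2) by (metis INT_D UNIV_I)
      show "\<exists>\<beta>. (z, \<beta>) \<in> ?G"
        by (rule exI[of _ "\<lambda>m. \<beta> (fst (prod_decode m)) (snd (prod_decode m))"]) (simp add: \<beta>)
    qed (auto simp: F(2))
  qed
qed

lemma souslin_UN:
  assumes "\<And>i::nat. souslin (A i)"
  shows "souslin (\<Union>i. A i)"
proof -
  have "\<forall>i. \<exists>F. closed F \<and> (\<forall>z. z \<in> A i \<longleftrightarrow> (\<exists>\<beta>::nat \<Rightarrow> nat. (z, \<beta>) \<in> F))"
    using assms by (meson souslinE)
  then obtain F where F: "\<And>i. closed (F i)" "\<And>i z. z \<in> A i \<longleftrightarrow> (\<exists>\<beta>::nat \<Rightarrow> nat. (z, \<beta>) \<in> F i)"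
    by metis
  \<comment> \<open>Entry 0 names an index \<open>i\<close> and the remaining entries witness
    membership in \<open>A i\<close>. Written as an implication for each \<open>i\<close>, this is
    an intersection of closed sets.\<close>
  let ?G = "\<Inter>i. ((\<lambda>w. snd w 0) -` (- {i}) \<union> (\<lambda>w. (fst w, \<lambda>n. snd w (Suc n))) -` F i)"
  show ?thesis
  proof (rule souslinI)
    have "continuous_on UNIV (\<lambda>w::'a \<times> (nat \<Rightarrow> nat). snd w 0)"
      by (rule continuous_on_product_then_coordinatewise) (intro continuous_on_snd continuous_on_id)
    then have "closed ((\<lambda>w::'a \<times> (nat \<Rightarrow> nat). snd w 0) -` (- {i}))" for i
      by (intro closed_vimage) (simp_all add: closed_def open_discrete)
    then show "closed ?G"
      by (intro closed_INT ballI closed_Un) (simp_all add: closed_vimage F continuous_on_reindex)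
    fix z
    show "z \<in> (\<Union>i. A i) \<longleftrightarrow> (\<exists>\<beta>. (z, \<beta>) \<in> ?G)"
    proof
      assume "z \<in> (\<Union>i. A i)"
      then obtain i \<beta> where \<beta>: "(z, \<beta>) \<in> F i"
        using F(2) by auto
      show "\<exists>\<beta>. (z, \<beta>) \<in> ?G"
        by (rule exI[of _ "case_nat i \<beta>"]) (simp add: \<beta>)
    qed (auto simp: F(2))
  qed
qed

text \<open>The sets that are Souslin together with their complements form a sigma-algebra. It
  contains the open sets, which are countable unions of closed sets in a metrizable space.\<close>

lemma souslin_borel:
  fixes A :: "'z::topological_space set"
  assumes m: "metrizable_space (euclidean :: 'z topology)" and A: "A \<in> sets borel"
  shows "souslin A"
proof -
  have op: "souslin U" if "open U" for U :: "'z set"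
  proof -
    have "fsigma_in euclidean U"
      using open_imp_fsigma_in[OF m] that by simp
    then obtain C where "\<And>n::nat. closed (C n)" "\<Union> (range C) = U"
      by (auto simp: fsigma_in_ascending)
    then show ?thesis
      using souslin_UN[of C] souslin_closed by blast
  qed
  have "A \<in> sigma_sets UNIV {U. open U}"
    using A by (simp add: borel_def)
  then have "souslin A \<and> souslin (- A)"
  proof induction
    case (Basic a)
    then show ?case by (simp add: op souslin_closed closed_Compl)
  next
    case Empty
    then show ?case by (simp add: souslin_closed)
  next
    case (Compl a)
    then show ?case by (metis Compl_eq_Diff_UNIV double_complement)
  next
    case (Union a)
    then show ?case
      unfolding Compl_UN by (intro conjI souslin_UN souslin_INT) blast+
  qed
  then show ?thesis by simp
qed

lemma metrizable_baire: "metrizable_space (euclidean :: (nat \<Rightarrow> nat) topology)"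
proof -
  have "(euclidean :: nat topology) = discrete_topology UNIV"
    by (simp add: topology_eq open_discrete)
  moreover have "metrizable_space (discrete_topology (UNIV :: nat set))"
    by (rule metrizable_space_discrete_topology)
  ultimately have "metrizable_space (euclidean :: nat topology)"
    by (simp only:)
  then have "metrizable_space (product_topology (\<lambda>_::nat. euclidean :: nat topology) UNIV)"
    unfolding metrizable_space_product_topology by (intro disjI2 conjI ballI countableI_type)
  then show ?thesis
    by (simp only: euclidean_product_topology)
qed

lemma metrizable_baire_triple:
  "metrizable_space (euclidean :: ((nat \<Rightarrow> nat) \<times> (nat \<Rightarrow> nat) \<times> (nat \<Rightarrow> nat)) topology)"
proof -
  have "metrizable_space (prod_topology (euclidean :: (nat \<Rightarrow> nat) topology)
      (prod_topology (euclidean :: (nat \<Rightarrow> nat) topology) (euclidean :: (nat \<Rightarrow> nat) topology)))"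
    by (simp only: metrizable_space_prod_topology metrizable_baire simp_thms)
  then show ?thesis
    by (simp only: prod_topology_euclidean)
qed

subsection \<open>Unary algebras of chains as LD-monoids\<close>

type_synonym link = "nat list \<times> nat list"

text \<open>In \<open>El n p\<close>, the list \<open>p\<close> holds pairs \<open>(v, a)\<close> of a point and the witness of the link from it to the
  next point, cut off at length \<open>n\<close>. The end point of the chain is implicit. Incorrect and ill-sized
  chains are elements too; only \<open>Test\<close> sees the difference, so the carrier is independent of \<open>x\<close>.\<close>

datatype elt = Zero | One | Fn nat | El nat "link list"

instance elt :: countable
  by countable_datatype

datatype fn = Trunc | Cons link | Test "nat list"

instance fn :: countable
  by countable_datatype

primrec start :: "(nat \<Rightarrow> nat) \<Rightarrow> nat \<Rightarrow> link list \<Rightarrow> nat list" where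
  "start x n [] = pre x n"
| "start x n (e # p) = fst e"

type_synonym tree3 = "nat list \<Rightarrow> nat list \<Rightarrow> nat list \<Rightarrow> bool"

primrec chain :: "tree3 \<Rightarrow> (nat \<Rightarrow> nat) \<Rightarrow> nat \<Rightarrow> link list \<Rightarrow> bool" where
  "chain T x n [] \<longleftrightarrow> True"
| "chain T x n (e # p) \<longleftrightarrow> T (fst e) (start x n p) (snd e) \<and> chain T x n p"

definition truncate :: "nat \<Rightarrow> link list \<Rightarrow> link list" where
  "truncate n = map (map_prod (take n) (take n))"

text \<open>Only level 0 is annihilated by \<open>Trunc\<close>, so iterating \<open>Trunc\<close>
  measures the level. A passed test returns its argument, an equation between nonzero elements that
  every embedding carries over.\<close>

definition act :: "tree3 \<Rightarrow> (nat \<Rightarrow> nat) \<Rightarrow> fn \<Rightarrow> nat \<Rightarrow> link list \<Rightarrow> elt" where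
  "act T x k n p = (case k of
       Trunc \<Rightarrow> (case n of 0 \<Rightarrow> Zero | Suc m \<Rightarrow> El m (truncate m p))
     | Cons e \<Rightarrow> El n (e # p)
     | Test u \<Rightarrow> if start x n p = u \<and> chain T x n p then El n p else Zero)"

text \<open>The products among the constants \<open>Fn i\<close> form a rigid pattern: only \<open>Fn 0\<close> has a nonzero square,
  and \<open>Fn (Suc i)\<close> is the only further element that \<open>Fn i\<close> does not annihilate.\<close>

definition star :: "tree3 \<Rightarrow> (nat \<Rightarrow> nat) \<Rightarrow> elt \<Rightarrow> elt \<Rightarrow> elt" where
  "star T x a b = (case b of
       Fn k \<Rightarrow> (case a of
           Fn i \<Rightarrow> if k = Suc i \<or> i = 0 \<and> k = 0 then One else Zero
         | El n p \<Rightarrow> act T x (from_nat k) n p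
         | _ \<Rightarrow> Zero)
     | _ \<Rightarrow> Zero)"

definition path_monoid :: "tree3 \<Rightarrow> (nat \<Rightarrow> nat) \<Rightarrow> elt two_ops" where
  "path_monoid T x = (\<lambda>_ _. Zero, star T x)"

abbreviation op :: "fn \<Rightarrow> elt" where
  "op k \<equiv> Fn (to_nat k)"

lemma star_simps [simp]:
  "star T x a Zero = Zero" "star T x a One = Zero" "star T x a (El n p) = Zero"
  "star T x Zero b = Zero" "star T x One b = Zero"
  "star T x (Fn i) (Fn k) = (if k = Suc i \<or> i = 0 \<and> k = 0 then One else Zero)"
  "star T x (El 0 p) (op Trunc) = Zero"
  "star T x (El (Suc m) p) (op Trunc) = El m (truncate m p)"
  "star T x (El n p) (op (Cons e)) = El n (e # p)"
  "star T x (El n p) (op (Test u)) = (if start x n p = u \<and> chain T x n p then El n p else Zero)"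
  by (auto simp: star_def act_def split: elt.split)

lemma star_El_Fn: "star T x (El n p) (Fn k) = act T x (from_nat k) n p"
  by (simp add: star_def)

lemma star_not_Fn [simp]: "star T x a b \<noteq> Fn k" "Fn k \<noteq> star T x a b"
  by (auto simp: star_def act_def split: elt.split fn.split nat.split)

text \<open>Only constants \<open>Fn k\<close> give nonzero products on the right, and no product is
  such a constant. With composition constantly \<open>Zero\<close> and \<open>Zero\<close> absorbing
  on both sides, this is all that the LD laws ask for.\<close>

lemma star_star [simp]: "star T x a (star T x b c) = Zero"
  by (cases "star T x b c") (auto dest: sym)

text \<open>This and the next lemma locate \<open>Fn 0\<close> by its square and then
  \<open>Fn (Suc i)\<close> from \<open>Fn i\<close>, for embeddings as well as in isomorphic
  copies.\<close>

lemma star_square_nonzero_iff: "star T x b b \<noteq> Zero \<longleftrightarrow> b = Fn 0"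
  by (cases b) auto

lemma star_Fn_nonzero_iff: "star T x (Fn i) b \<noteq> Zero \<longleftrightarrow> b = Fn (Suc i) \<or> i = 0 \<and> b = Fn 0"
  by (cases b) auto

lemma hom_path_monoid:
  "two_ops_hom h (path_monoid T x) S \<longleftrightarrow>
     (\<forall>a b. h Zero = fst S (h a) (h b)) \<and> (\<forall>a b. h (star T x a b) = snd S (h a) (h b))"
  by (simp add: two_ops_hom_def path_monoid_def)

section \<open>Projections of branches, and embeddings between the algebras\<close>

definition link_rel :: "tree3 \<Rightarrow> (nat \<Rightarrow> nat) rel" where
  "link_rel T = {(x, y). \<exists>\<alpha>. \<forall>n. T (pre x n) (pre y n) (pre \<alpha> n)}"

lemma start_append: "start y n (p @ [(pre x n, a)]) = start x n p"
  by (cases p) auto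

text \<open>The new pair stands where the implicit end point \<open>x\<close> stood. All earlier
  links are therefore tested as before, and the additional one holds by assumption.\<close>

lemma chain_append:
  "T (pre x n) (pre y n) a \<Longrightarrow> chain T y n (p @ [(pre x n, a)]) = chain T x n p"
  by (induction p) (auto simp: start_append)

lemma link_rel_imp_embedding:
  assumes "(x, y) \<in> link_rel T"
  shows "\<exists>h. inj h \<and> two_ops_hom h (path_monoid T x) (path_monoid T y)"
proof -
  obtain \<alpha> where \<alpha>: "\<And>n. T (pre x n) (pre y n) (pre \<alpha> n)"
    using assms by (auto simp: link_rel_def)
  define h where
    "h e = (case e of El n p \<Rightarrow> El n (p @ [(pre x n, pre \<alpha> n)]) | _ \<Rightarrow> e)" for e
  have h: "h Zero = Zero" "h One = One" "h (Fn k) = Fn k"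
    "h (El n p) = El n (p @ [(pre x n, pre \<alpha> n)])" for k n p
    by (simp_all add: h_def)
  have "inj h"
    by (rule injI) (auto simp: h_def split: elt.splits)
  have c: "chain T y n (p @ [(pre x n, pre \<alpha> n)]) = chain T x n p" for n p
    by (rule chain_append) (rule \<alpha>)
  \<comment> \<open>Prepending commutes with appending, truncation turns the appended link into that
    of the level below, and tests have the same outcome by \<open>start_append\<close> and
    \<open>c\<close>.\<close>
  have "h (act T x k n p) = act T y k n (p @ [(pre x n, pre \<alpha> n)])" for k n p
    by (auto simp: act_def h start_append c truncate_def take_pre
        split: fn.split nat.split)
  then have "h (star T x a b) = star T y (h a) (h b)" for a b
    by (cases b; cases a) (simp_all add: h star_El_Fn)
  then have "two_ops_hom h (path_monoid T x) (path_monoid T y)"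
    unfolding hom_path_monoid by (simp add: path_monoid_def h)
  with \<open>inj h\<close> show ?thesis by blast
qed

lemma length_truncate [simp]: "length (truncate n p) = length p"
  by (simp add: truncate_def)

lemma start_truncate: "start x n (truncate n p) = take n (start x (Suc n) p)"
  by (cases p) (auto simp: truncate_def take_pre)

text \<open>Truncation preserves the number of links, so all \<open>q n\<close> have the same
  length; the induction is on it. The first links converge to a link from \<open>x\<close> to some
  \<open>z\<close>, and the tails form a coherent sequence of shorter chains from \<open>z\<close>
  to \<open>y\<close>.\<close>

lemma limit_of_chains:
  assumes len: "\<And>u v a. T u v a \<Longrightarrow> length u = length v \<and> length v = length a"
    and "\<And>n. chain T y n (q n)"
    and "\<And>n. start y n (q n) = pre x n"
    and "\<And>n. q n = truncate n (q (Suc n))"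
  shows "(x, y) \<in> (link_rel T)\<^sup>*"
  using assms(2-)
proof (induction "length (q 0)" arbitrary: q x)
  case (0 q)
  have l: "length (q (Suc n)) = length (q n)" for n
    using arg_cong[OF "0.prems"(3)[of n], of length] by simp
  have "length (q n) = 0" for n
    by (induction n) (simp_all only: l "0.hyps"[symmetric])
  then have "pre y n = pre x n" for n
    using "0.prems"(2)[of n] by simp
  then have "x = y"
    unfolding pre_inject[symmetric] by simp
  then show ?case by simp
next
  case (Suc k q)
  have l: "length (q (Suc n)) = length (q n)" for n
    using arg_cong[OF Suc.prems(3)[of n], of length] by simp
  have lq: "length (q n) = Suc k" for n
    by (induction n) (simp_all only: l Suc.hyps(2)[symmetric])
  define e where "e n = hd (q n)" for n
  define r where "r n = tl (q n)" for n
  have q: "q n = e n # r n" for n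
    using lq[of n] by (cases "q n") (auto simp: e_def r_def)
  have ch: "chain T y n (r n)" and Te: "T (fst (e n)) (start y n (r n)) (snd (e n))" for n
    using Suc.prems(1)[of n] by (simp_all add: q)
  have fe: "fst (e n) = pre x n" for n
    using Suc.prems(2)[of n] by (simp add: q)
  have tr: "r n = truncate n (r (Suc n))" and te: "e n = map_prod (take n) (take n) (e (Suc n))" for n
    using Suc.prems(3)[of n] unfolding q truncate_def list.map list.inject by simp_all
  \<comment> \<open>The first link satisfies \<open>T\<close> and starts at a list of length
    \<open>n\<close>. This forces length \<open>n\<close> on its witness and on the next point,
    which are therefore prefixes of limits.\<close>
  have ls: "length (snd (e n)) = n" and lr: "length (start y n (r n)) = n" for n
    using len[OF Te[of n]] by (simp_all add: fe)
  obtain \<alpha> where \<alpha>: "\<And>n. snd (e n) = pre \<alpha> n"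
  proof (rule coherent_prefixes[of "\<lambda>n. snd (e n)"])
    show "snd (e n) = take n (snd (e (Suc n)))" for n
      using arg_cong[OF te[of n], of snd] by simp
  qed (rule ls, blast)
  obtain z where z: "\<And>n. start y n (r n) = pre z n"
  proof (rule coherent_prefixes[of "\<lambda>n. start y n (r n)"])
    show "start y n (r n) = take n (start y (Suc n) (r (Suc n)))" for n
      using start_truncate[of y n "r (Suc n)"] tr[of n] by simp
  qed (rule lr, blast)
  have "(z, y) \<in> (link_rel T)\<^sup>*"
  proof (rule Suc.hyps(1)[OF _ ch z tr])
    show "k = length (r 0)"
      using lq[of 0] by (simp add: q)
  qed
  moreover have "(x, z) \<in> link_rel T"
    using Te by (auto simp: link_rel_def fe \<alpha> z)
  ultimately show ?case
    by (meson converse_rtrancl_into_rtrancl)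
qed

text \<open>Constant composition fixes \<open>Zero\<close> and the rigid pattern fixes all
  \<open>Fn k\<close>, so \<open>h\<close> commutes with every named operation. \<open>Test\<close>
  then makes the image of \<open>El n []\<close> a correct chain starting at \<open>x\<close>, and
  \<open>Trunc\<close> makes these images coherent.\<close>

lemma embedding_imp_link_rel:
  assumes len: "\<And>u v a. T u v a \<Longrightarrow> length u = length v \<and> length v = length a"
    and inj: "inj h" and hom: "two_ops_hom h (path_monoid T x) (path_monoid T y)"
  shows "(x, y) \<in> (link_rel T)\<^sup>*"
proof -
  have hZ [simp]: "h Zero = Zero" and hs: "h (star T x a b) = star T y (h a) (h b)" for a b
    using hom unfolding hom_path_monoid by (simp_all add: path_monoid_def)
  have nz: "star T y (h a) (h b) = Zero \<longleftrightarrow> star T x a b = Zero" for a b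
    using inj_eq[OF inj, of "star T x a b" Zero] by (simp only: hs hZ)
  have hF [simp]: "h (Fn k) = Fn k" for k
  proof (induction k)
    case 0
    show ?case
      using nz[of "Fn 0" "Fn 0"] star_square_nonzero_iff[of T y "h (Fn 0)"] by simp
  next
    case (Suc k)
    \<comment> \<open>For \<open>k = 0\<close> the product pattern alone would also admit the value
      \<open>Fn 0\<close>.\<close>
    have "h (Fn (Suc k)) \<noteq> h (Fn k)"
      using inj_eq[OF inj, of "Fn (Suc k)" "Fn k"] by simp
    then show ?case
      using nz[of "Fn k" "Fn (Suc k)"] Suc star_Fn_nonzero_iff[of T y k "h (Fn (Suc k))"] by auto
  qed
  have "\<exists>q. h (El n []) = El n q \<and> start y n q = pre x n \<and> chain T y n q" for n
  proof -
    \<comment> \<open>The test for \<open>pre x n\<close> succeeds at the empty chain, hence at its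
      image; a nonzero outcome is possible only at an element \<open>El m q\<close>.\<close>
    have "star T y (h (El n [])) (op (Test (pre x n))) = h (El n [])"
      using hs[of "El n []" "op (Test (pre x n))"] by simp
    moreover have "h (El n []) \<noteq> Zero"
      using inj_eq[OF inj, of "El n []" Zero] by simp
    ultimately obtain m q where mq: "h (El n []) = El m q" "start y m q = pre x n" "chain T y m q"
      by (cases "h (El n [])") (auto split: if_splits dest: sym)
    \<comment> \<open>Both levels descend in step under \<open>Trunc\<close>, and they reach 0
      together because \<open>h\<close> reflects \<open>Zero\<close>.\<close>
    have "m = n" using mq(1)
    proof (induction n arbitrary: m q)
      case 0
      then show ?case
        using nz[of "El 0 []" "op Trunc"] by (cases m) auto
    next
      case (Suc n)
      have "star T y (El m q) (op Trunc) = h (El n [])"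
        using hs[of "El (Suc n) []" "op Trunc"] Suc.prems by (simp add: truncate_def)
      moreover have "h (El n []) \<noteq> Zero"
        using inj_eq[OF inj, of "El n []" Zero] by simp
      ultimately show ?case
        using Suc.IH by (cases m) (auto dest: sym)
    qed
    with mq show ?thesis by blast
  qed
  then have "\<exists>q. \<forall>n. h (El n []) = El n (q n) \<and> start y n (q n) = pre x n \<and> chain T y n (q n)"
    by (intro choice allI)
  then obtain q where q: "\<And>n. h (El n []) = El n (q n)"
      "\<And>n. start y n (q n) = pre x n" "\<And>n. chain T y n (q n)"
    by blast
  show ?thesis
  proof (rule limit_of_chains)
    show "q n = truncate n (q (Suc n))" for n
      using hs[of "El (Suc n) []" "op Trunc"] by (simp add: q truncate_def)
  qed (use len q in auto)
qed

lemma embedding_iff_link_rel: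
  assumes len: "\<And>u v a. T u v a \<Longrightarrow> length u = length v \<and> length v = length a"
    and trans: "trans (link_rel T)" and refl: "(x, x) \<in> link_rel T"
  shows "(\<exists>h. inj h \<and> two_ops_hom h (path_monoid T x) (path_monoid T y)) \<longleftrightarrow> (x, y) \<in> link_rel T"
proof
  assume "\<exists>h. inj h \<and> two_ops_hom h (path_monoid T x) (path_monoid T y)"
  then have "(x, y) \<in> (link_rel T)\<^sup>*"
    using embedding_imp_link_rel[of T] len by blast
  \<comment> \<open>Chains without links give \<open>x = y\<close>, which reflexivity at
    \<open>x\<close> settles; all others collapse by transitivity.\<close>
  then show "(x, y) \<in> link_rel T"
    using trans refl by (simp add: rtrancl_eq_or_trancl) (metis trancl_id)
qed (rule link_rel_imp_embedding)

subsection \<open>Standard Borel spaces and analytic relations\<close>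

lemma measurable_baire_coordinate [measurable]:
  "(\<lambda>z. z n) \<in> (borel :: (nat \<Rightarrow> nat) measure) \<rightarrow>\<^sub>M count_space UNIV"
  by (rule measurable_coordinate) simp

lemma standard_borel_dense_sequence:
  assumes "standard_borel M" "space M \<noteq> {}"
  obtains d and q :: "nat \<Rightarrow> 'a" where "Metric_space (space M) d" "Metric_space.mcomplete (space M) d"
    "sets M = sigma_sets (space M) {U. openin (Metric_space.mtopology (space M) d) U}"
    "\<And>n. q n \<in> space M" "\<And>x e. x \<in> space M \<Longrightarrow> 0 < e \<Longrightarrow> \<exists>n. d (q n) x < e"
proof -
  obtain T where T: "completely_metrizable_space T" "second_countable T" "space M = topspace T"
      "sets M = sigma_sets (topspace T) {U. openin T U}"
    using assms(1) by (auto simp: standard_borel_def)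
  obtain S d where Sd: "Metric_space S d" "Metric_space.mcomplete S d"
      "T = Metric_space.mtopology S d"
    using T(1) by (auto simp: completely_metrizable_space_def)
  have S: "S = space M"
    using T(3) Sd(3) Metric_space.topspace_mtopology[OF Sd(1)] by simp
  interpret Metric_space "space M" d
    using Sd(1) unfolding S .
  have Td: "T = mtopology"
    using Sd(3) unfolding S .
  obtain B where "countable B" and "\<forall>U x. openin T U \<and> x \<in> U \<longrightarrow> (\<exists>V\<in>B. x \<in> V \<and> V \<subseteq> U)"
    using T(2) unfolding second_countable_def by (elim exE conjE)
  then have B: "countable B" "\<And>U x. openin T U \<Longrightarrow> x \<in> U \<Longrightarrow> \<exists>V\<in>B. x \<in> V \<and> V \<subseteq> U"
    by simp_all
  \<comment> \<open>One point from each nonempty basic set gives a countable dense set.\<close>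
  define Q where "Q = (\<lambda>V. SOME y. y \<in> V) ` {V \<in> B. V \<subseteq> space M \<and> V \<noteq> {}}"
  have Q_meets: "\<exists>y\<in>Q. y \<in> U" if U: "openin T U" "x \<in> U" for U x
  proof -
    obtain V where V: "V \<in> B" "x \<in> V" "V \<subseteq> U"
      using B(2) U by blast
    moreover have "U \<subseteq> space M"
      using U(1) T(3) openin_subset by blast
    moreover have "(SOME y. y \<in> V) \<in> V"
      using V(2) by (rule someI)
    ultimately show ?thesis
      unfolding Q_def by blast
  qed
  have "Q \<subseteq> space M"
    unfolding Q_def using some_in_eq by blast
  have "countable Q"
    unfolding Q_def using B(1) by simp
  obtain x0 where "x0 \<in> space M"
    using assms(2) by blast
  then have "Q \<noteq> {}"
    using Q_meets[of "topspace T" x0] T(3) by auto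
  have range: "range (from_nat_into Q) = Q"
    using \<open>Q \<noteq> {}\<close> \<open>countable Q\<close> by (rule range_from_nat_into)
  show thesis
  proof (rule that)
    show "Metric_space (space M) d" "Metric_space.mcomplete (space M) d"
      "sets M = sigma_sets (space M) {U. openin (Metric_space.mtopology (space M) d) U}"
      using Sd(1,2) T(4)[folded T(3)] unfolding S Td by this+
    show "from_nat_into Q n \<in> space M" for n
      using range \<open>Q \<subseteq> space M\<close> by blast
    show "\<exists>n. d (from_nat_into Q n) x < e" if "x \<in> space M" "0 < e" for x e
    proof -
      have "x \<in> mball x e"
        using that by simp
      then obtain y where "y \<in> Q" "y \<in> mball x e"
        using Q_meets[of "mball x e" x] Td by auto
      moreover obtain n where "y = from_nat_into Q n"
        using range \<open>y \<in> Q\<close> by blast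
      ultimately show ?thesis
        by (auto simp: commute)
    qed
  qed
qed

text \<open>The code of a point lists, for each \<open>k\<close>, an element of a dense sequence at distance less than
  \<open>1 / (k + 1)\<close>; its left inverse takes limits, which makes the range of the coding Borel.\<close>

lemma standard_borel_coding:
  assumes "standard_borel M" "space M \<noteq> {}"
  obtains \<iota> :: "'a \<Rightarrow> nat \<Rightarrow> nat" and \<pi> where "\<iota> \<in> M \<rightarrow>\<^sub>M borel" "\<pi> \<in> borel \<rightarrow>\<^sub>M M"
    "\<And>x. x \<in> space M \<Longrightarrow> \<pi> (\<iota> x) = x"
proof -
  obtain d and q :: "nat \<Rightarrow> 'a" where "Metric_space (space M) d"
    and comp: "Metric_space.mcomplete (space M) d"
    and sets: "sets M = sigma_sets (space M) {U. openin (Metric_space.mtopology (space M) d) U}"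
    and q: "\<And>n. q n \<in> space M" and dense: "\<And>x e. x \<in> space M \<Longrightarrow> 0 < e \<Longrightarrow> \<exists>n. d (q n) x < e"
    using standard_borel_dense_sequence[OF assms] by metis
  interpret Metric_space "space M" d by fact
  define r where "r k = inverse (real (Suc k))" for k
  have r_pos: "0 < r k" for k
    by (simp add: r_def)
  have r_small: "\<exists>K. \<forall>k\<ge>K. r k < e" if "0 < e" for e
  proof -
    obtain K where K: "r K < e"
      using reals_Archimedean[OF \<open>0 < e\<close>] by (auto simp: r_def)
    have "r k \<le> r K" if "K \<le> k" for k
      using that by (simp add: r_def field_simps)
    with K show ?thesis by (meson le_less_trans)
  qed
  define \<iota> where "\<iota> x k = (LEAST n. d (q n) x < r k)" for x k
  \<comment> \<open>For \<open>z \<in> C\<close> the points \<open>q (z k)\<close> form a Cauchy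
    sequence with a prescribed rate. Outside \<open>C\<close> the decoding takes the default value
    \<open>q 0\<close>.\<close>
  define C where "C = {z. \<forall>k l. d (q (z k)) (q (z l)) \<le> r k + r l}"
  define lim where "lim z y \<longleftrightarrow> y \<in> space M \<and> (\<forall>k. d (q (z k)) y \<le> r k)" for z y
  define \<pi> where "\<pi> z = (if z \<in> C then SOME y. lim z y else q 0)" for z
  have lim_unique: "y = y'" if "lim z y" "lim z y'" for z y y'
  proof (rule ccontr)
    assume "y \<noteq> y'"
    then have "0 < d y y' / 2"
      using that by (simp add: lim_def)
    then obtain k where "r k < d y y' / 2"
      using r_small by blast
    moreover have "d y y' \<le> d (q (z k)) y + d (q (z k)) y'"
      using that triangle''[of y "q (z k)" y'] q by (simp add: lim_def commute)
    ultimately show False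
      using that by (smt (verit) lim_def field_sum_of_halves)
  qed
  have lim_exists: "\<exists>y. lim z y" if "z \<in> C" for z
  proof -
    have "MCauchy (\<lambda>k. q (z k))"
      unfolding MCauchy_def
    proof (intro conjI allI impI)
      fix e :: real assume "0 < e"
      then obtain K where K: "\<forall>k\<ge>K. r k < e / 2"
        using r_small[of "e / 2"] by auto
      show "\<exists>N. \<forall>n n'. N \<le> n \<longrightarrow> N \<le> n' \<longrightarrow> d (q (z n)) (q (z n')) < e"
      proof (intro exI[of _ K] allI impI)
        fix n n' assume "K \<le> n" "K \<le> n'"
        then have "r n + r n' < e"
          using K by (smt (verit) field_sum_of_halves)
        moreover have "d (q (z n)) (q (z n')) \<le> r n + r n'"
          using that by (simp add: C_def)
        ultimately show "d (q (z n)) (q (z n')) < e" by simp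
      qed
    qed (use q in auto)
    then obtain y where y: "limitin mtopology (\<lambda>k. q (z k)) y sequentially"
      using comp by (auto simp: mcomplete_def)
    have yM: "y \<in> space M"
      using y limitin_mspace by blast
    \<comment> \<open>Letting \<open>l\<close> grow in the bound \<open>r k + r l\<close> leaves
      \<open>r k\<close> for the limit.\<close>
    have "d (q (z k)) y \<le> r k" for k
    proof (rule field_le_epsilon)
      fix e :: real assume e: "0 < e"
      then obtain K where K: "\<forall>l\<ge>K. r l < e / 2"
        using r_small[of "e / 2"] by auto
      obtain L where L: "\<forall>l\<ge>L. q (z l) \<in> space M \<and> d (q (z l)) y < e / 2"
        using y half_gt_zero[OF e] unfolding limit_metric_sequentially by blast
      define l where "l = max K L"
      have "d (q (z k)) y \<le> d (q (z k)) (q (z l)) + d (q (z l)) y"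
        by (rule triangle) (use q yM in auto)
      moreover have "d (q (z k)) (q (z l)) \<le> r k + r l"
        using that by (simp add: C_def)
      moreover have "r l < e / 2" "d (q (z l)) y < e / 2"
        using K L by (auto simp: l_def)
      ultimately show "d (q (z k)) y \<le> r k + e" by linarith
    qed
    with yM show ?thesis by (auto simp: lim_def)
  qed
  have lim_\<pi>: "lim z (\<pi> z)" if "z \<in> C" for z
    using someI_ex[OF lim_exists[OF that]] that by (simp add: \<pi>_def)
  have \<pi>_space: "\<pi> z \<in> space M" for z
    using lim_\<pi>[of z] q by (cases "z \<in> C") (simp_all add: lim_def \<pi>_def)
  have near: "d (q (\<iota> x k)) x < r k" if "x \<in> space M" for x k
    unfolding \<iota>_def using dense[OF that r_pos[of k]] by (rule LeastI_ex)
  show thesis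
  proof
    have [measurable]: "Measurable.pred M (\<lambda>x. d (q n) x < r k)" for n k
    proof -
      have "mball (q n) (r k) \<in> sets M"
        unfolding sets by (rule sigma_sets.Basic) simp
      moreover have "{x \<in> space M. d (q n) x < r k} = mball (q n) (r k)"
        using q by auto
      ultimately show ?thesis
        by (simp add: pred_def)
    qed
    show "\<iota> \<in> M \<rightarrow>\<^sub>M borel"
      by (rule measurable_into_baire) (simp add: \<iota>_def)
    show "\<pi> \<in> borel \<rightarrow>\<^sub>M M"
    proof (rule measurable_sigma_sets[OF sets])
      show "{U. openin mtopology U} \<subseteq> Pow (space M)"
        using openin_subset by fastforce
      show "\<pi> \<in> space borel \<rightarrow> space M"
        using \<pi>_space by simp
      fix U assume "U \<in> {U. openin mtopology U}"
      then have U: "openin mtopology U" by simp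
      have "Measurable.pred borel (\<lambda>z. \<forall>k l. \<exists>m n. z k = m \<and> z l = n \<and> d (q m) (q n) \<le> r k + r l)"
        by measurable
      then have C: "C \<in> sets borel"
        by (simp add: C_def pred_def)
      \<comment> \<open>On \<open>C\<close> the entry \<open>z k\<close> determines
        \<open>\<pi> z\<close> up to distance \<open>r k + r k\<close>, so \<open>\<pi>\<close> is
        continuous there: the preimage of \<open>U\<close> is a union of countably many
        cylinders.\<close>
      define J where "J = {(k, n). \<forall>z\<in>C. z k = n \<longrightarrow> \<pi> z \<in> U}"
      have cyl: "{z :: nat \<Rightarrow> nat. z k = n} \<in> sets borel" for k n
        using measurable_sets[OF measurable_baire_coordinate[of k], of "{n}"] by (simp add: vimage_def)
      have "\<pi> -` U \<inter> C = C \<inter> (\<Union>(k, n)\<in>J. {z. z k = n})"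
      proof (intro equalityI subsetI)
        fix z assume z: "z \<in> \<pi> -` U \<inter> C"
        then obtain e where e: "0 < e" "mball (\<pi> z) e \<subseteq> U"
          using U by (auto simp: openin_mtopology)
        then obtain k where k: "r k < e / 2"
          using r_small[of "e / 2"] by auto
        have "\<pi> z' \<in> U" if "z' \<in> C" "z' k = z k" for z'
        proof -
          have "d (\<pi> z) (\<pi> z') \<le> d (q (z k)) (\<pi> z) + d (q (z k)) (\<pi> z')"
            using triangle''[of "\<pi> z" "q (z k)" "\<pi> z'"] q \<pi>_space by (simp add: commute)
          also have "\<dots> \<le> r k + r k"
          proof (rule add_mono)
            show "d (q (z k)) (\<pi> z) \<le> r k"
              using lim_\<pi>[of z] z by (simp add: lim_def)
            show "d (q (z k)) (\<pi> z') \<le> r k"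
              using lim_\<pi>[OF that(1)] unfolding lim_def that(2)[symmetric] by blast
          qed
          also have "\<dots> < e" using k by simp
          finally show ?thesis
            using e(2) \<pi>_space by auto
        qed
        then have "(k, z k) \<in> J" by (auto simp: J_def)
        then show "z \<in> C \<inter> (\<Union>(k, n)\<in>J. {z. z k = n})"
          using z by blast
      qed (auto simp: J_def)
      moreover have "(\<Union>(k, n)\<in>J. {z :: nat \<Rightarrow> nat. z k = n}) \<in> sets borel"
        by (rule sets.countable_UN') (auto intro: cyl)
      ultimately have "\<pi> -` U \<inter> C \<in> sets borel"
        using C by simp
      moreover have "(if q 0 \<in> U then - C else {}) \<in> sets borel"
        using C by auto
      ultimately have "(\<pi> -` U \<inter> C) \<union> (if q 0 \<in> U then - C else {}) \<in> sets borel"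
        by (rule sets.Un)
      also have "(\<pi> -` U \<inter> C) \<union> (if q 0 \<in> U then - C else {}) = \<pi> -` U \<inter> space borel"
        by (auto simp: \<pi>_def split: if_splits)
      finally show "\<pi> -` U \<inter> space borel \<in> sets borel" .
    qed
    fix x assume x: "x \<in> space M"
    have "d (q (\<iota> x k)) (q (\<iota> x l)) \<le> r k + r l" for k l
      using triangle'[of "q (\<iota> x k)" x "q (\<iota> x l)"] near[OF x, of k] near[OF x, of l] q x
      by (simp add: commute)
    then have "\<iota> x \<in> C" by (simp add: C_def)
    moreover have "lim (\<iota> x) x"
      using near[OF x] x by (auto simp: lim_def intro: less_imp_le)
    ultimately show "\<pi> (\<iota> x) = x"
      using lim_\<pi> lim_unique by blast
  qed
qed

section \<open>Tree representations of analytic relations\<close>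

definition interleave :: "(nat \<Rightarrow> nat) \<Rightarrow> (nat \<Rightarrow> nat) \<Rightarrow> nat \<Rightarrow> nat" where
  "interleave z \<beta> n = (if even n then z (n div 2) else \<beta> (n div 2))"

lemma interleave_simps [simp]:
  "(\<lambda>n. interleave z \<beta> (2 * n)) = z" "(\<lambda>n. interleave z \<beta> (Suc (2 * n))) = \<beta>"
  by (auto simp: interleave_def)

text \<open>A closed set is exactly the set of branches through the tree of its prefixes.\<close>

lemma link_rel_of_closed:
  fixes F :: "((nat \<Rightarrow> nat) \<times> (nat \<Rightarrow> nat) \<times> (nat \<Rightarrow> nat)) set"
  assumes F: "closed F"
  obtains T where "\<And>u v a. T u v a \<Longrightarrow> length u = length v \<and> length v = length a"
    "link_rel T = {(x, y). \<exists>\<gamma>. (x, y, \<gamma>) \<in> F}"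
proof
  define T where "T u v a \<longleftrightarrow> length u = length v \<and> length v = length a \<and>
      (\<exists>(x, y, \<gamma>) \<in> F. pre x (length u) = u \<and> pre y (length u) = v \<and> pre \<gamma> (length u) = a)" for u v a
  show "length u = length v \<and> length v = length a" if "T u v a" for u v a
    using that by (simp add: T_def)
  have "(\<forall>n. T (pre x n) (pre y n) (pre \<gamma> n)) \<longleftrightarrow> (x, y, \<gamma>) \<in> F" for x y \<gamma>
  proof
    assume "\<forall>n. T (pre x n) (pre y n) (pre \<gamma> n)"
    then show "(x, y, \<gamma>) \<in> F"
      by (intro closed_if_agree_on_prefixes[OF F]) (simp add: T_def)
  next
    assume "(x, y, \<gamma>) \<in> F"
    then show "\<forall>n. T (pre x n) (pre y n) (pre \<gamma> n)"
      by (auto simp: T_def intro!: bexI[of _ "(x, y, \<gamma>)"])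
  qed
  then show "link_rel T = {(x, y). \<exists>\<gamma>. (x, y, \<gamma>) \<in> F}"
    by (simp add: link_rel_def)
qed

text \<open>A Borel set is the projection of a closed set. The projected coordinate is merged with
  \<open>z\<close> into one witness, \<open>z\<close> at the even places and the new one at the odd
  places.\<close>

lemma link_rel_of_borel:
  fixes G :: "((nat \<Rightarrow> nat) \<times> (nat \<Rightarrow> nat) \<times> (nat \<Rightarrow> nat)) set"
  assumes "G \<in> sets borel"
  obtains T where "\<And>u v a. T u v a \<Longrightarrow> length u = length v \<and> length v = length a"
    "link_rel T = {(x, y). \<exists>z. (x, y, z) \<in> G}"
proof -
  obtain F where F: "closed F" and G: "\<And>w. w \<in> G \<longleftrightarrow> (\<exists>\<beta>::nat \<Rightarrow> nat. (w, \<beta>) \<in> F)"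
    using souslin_borel[OF metrizable_baire_triple assms] by (elim souslinE) blast
  let ?j = "\<lambda>w :: (nat \<Rightarrow> nat) \<times> (nat \<Rightarrow> nat) \<times> (nat \<Rightarrow> nat).
      ((fst w, fst (snd w), \<lambda>n. snd (snd w) (2 * n)), \<lambda>n. snd (snd w) (Suc (2 * n)))"
  have c: "continuous_on UNIV (\<lambda>w :: (nat \<Rightarrow> nat) \<times> (nat \<Rightarrow> nat) \<times> (nat \<Rightarrow> nat). snd (snd w) (i n))"
    for i :: "nat \<Rightarrow> nat" and n
    by (rule continuous_on_product_then_coordinatewise) (intro continuous_on_snd continuous_on_id)
  have "continuous_on UNIV ?j"
    by (intro continuous_on_Pair continuous_on_fst continuous_on_snd continuous_on_id
        continuous_on_coordinatewise_then_product c)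
  then have "closed (?j -` F)"
    using F by (simp add: closed_vimage)
  then obtain T where T: "\<And>u v a. T u v a \<Longrightarrow> length u = length v \<and> length v = length a"
      and rel: "link_rel T = {(x, y). \<exists>\<gamma>. (x, y, \<gamma>) \<in> ?j -` F}"
    by (rule link_rel_of_closed) blast
  have "(\<exists>\<gamma>. (x, y, \<gamma>) \<in> ?j -` F) \<longleftrightarrow> (\<exists>z. (x, y, z) \<in> G)" for x y
  proof
    assume "\<exists>z. (x, y, z) \<in> G"
    then obtain z \<beta> where "((x, y, z), \<beta>) \<in> F"
      using G by blast
    then have "(x, y, interleave z \<beta>) \<in> ?j -` F"
      by simp
    then show "\<exists>\<gamma>. (x, y, \<gamma>) \<in> ?j -` F" by blast
  qed (auto simp: G)
  with rel have "link_rel T = {(x, y). \<exists>z. (x, y, z) \<in> G}"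
    by simp
  with T show thesis
    by (rule that)
qed

lemma analytic_link_rel:
  assumes A: "analytic_in (M \<Otimes>\<^sub>M M) R" and \<iota>: "\<iota> \<in> M \<rightarrow>\<^sub>M (borel :: (nat \<Rightarrow> nat) measure)"
  obtains T where "\<And>u v a. T u v a \<Longrightarrow> length u = length v \<and> length v = length a"
    "link_rel T = {(\<iota> a, \<iota> b) | a b. (a, b) \<in> R}"
proof -
  obtain N :: "(nat \<Rightarrow> nat) measure" and f where N: "standard_borel N"
      and f: "f \<in> N \<rightarrow>\<^sub>M M \<Otimes>\<^sub>M M" and R: "R = f ` space N"
    using A by (auto simp: analytic_in_def)
  show thesis
  \<comment> \<open>The coding asks for a point of \<open>N\<close>; if there is none,
    \<open>R\<close> is empty and \<open>T\<close> can be constantly false.\<close>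
  proof (cases "space N = {}")
    case True
    show thesis
      by (rule that[of "\<lambda>_ _ _. False"]) (simp_all add: link_rel_def R True)
  next
    case False
    obtain \<kappa> \<pi> where \<kappa>: "\<kappa> \<in> N \<rightarrow>\<^sub>M (borel :: (nat \<Rightarrow> nat) measure)" and \<pi>: "\<pi> \<in> borel \<rightarrow>\<^sub>M N"
        and inv: "\<And>p. p \<in> space N \<Longrightarrow> \<pi> (\<kappa> p) = p"
      by (rule standard_borel_coding[OF N False]) blast
    \<comment> \<open>The third sequence codes a parameter in \<open>N\<close> whose image under
      \<open>f\<close> is the related pair. Since \<open>\<pi>\<close> maps every sequence into
      \<open>space N\<close>, it ranges over all sequences, and \<open>G\<close> is given by
      equalities of Borel maps.\<close>
    define G where "G = {w. fst w = \<iota> (fst (f (\<pi> (snd (snd w))))) \<and>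
        fst (snd w) = \<iota> (snd (f (\<pi> (snd (snd w)))))}"
    have \<pi>_space: "\<pi> z \<in> space N" for z
      using measurable_space[OF \<pi>] by simp
    have third: "(\<lambda>w. snd (snd w)) \<in> borel \<rightarrow>\<^sub>M (borel :: (nat \<Rightarrow> nat) measure)"
      by (intro borel_measurable_continuous_onI continuous_on_snd continuous_on_id)
    have fst: "(\<lambda>w :: (nat \<Rightarrow> nat) \<times> (nat \<Rightarrow> nat) \<times> (nat \<Rightarrow> nat). fst w) \<in> borel \<rightarrow>\<^sub>M borel"
      by (intro borel_measurable_continuous_onI continuous_on_fst continuous_on_id)
    have snd: "(\<lambda>w :: (nat \<Rightarrow> nat) \<times> (nat \<Rightarrow> nat) \<times> (nat \<Rightarrow> nat). fst (snd w)) \<in> borel \<rightarrow>\<^sub>M borel"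
      by (intro borel_measurable_continuous_onI continuous_on_fst continuous_on_snd continuous_on_id)
    have f\<pi>: "(\<lambda>w :: (nat \<Rightarrow> nat) \<times> (nat \<Rightarrow> nat) \<times> (nat \<Rightarrow> nat). f (\<pi> (snd (snd w)))) \<in> borel \<rightarrow>\<^sub>M M \<Otimes>\<^sub>M M"
      by (rule measurable_compose[OF measurable_compose[OF third \<pi>] f])
    have "Measurable.pred borel (\<lambda>w. fst w = \<iota> (fst (f (\<pi> (snd (snd w))))) \<and>
        fst (snd w) = \<iota> (snd (f (\<pi> (snd (snd w))))))"
      by (intro pred_intros_logic pred_eq_baire fst snd
          measurable_compose[OF measurable_compose[OF f\<pi> measurable_fst] \<iota>]
          measurable_compose[OF measurable_compose[OF f\<pi> measurable_snd] \<iota>])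
    then have "G \<in> sets borel"
      by (simp add: pred_def G_def)
    then obtain T where T: "\<And>u v a. T u v a \<Longrightarrow> length u = length v \<and> length v = length a"
        and rel: "link_rel T = {(x, y). \<exists>z. (x, y, z) \<in> G}"
      by (rule link_rel_of_borel) blast
    have "{(x, y). \<exists>z. (x, y, z) \<in> G} = {(\<iota> a, \<iota> b) | a b. (a, b) \<in> R}"
    proof (intro equalityI subsetI)
      fix w assume "w \<in> {(x, y). \<exists>z. (x, y, z) \<in> G}"
      then obtain z where "w = (\<iota> (fst (f (\<pi> z))), \<iota> (snd (f (\<pi> z))))"
        by (auto simp: G_def)
      moreover have "(fst (f (\<pi> z)), snd (f (\<pi> z))) \<in> R"
        using \<pi>_space[of z] by (simp add: R)
      ultimately show "w \<in> {(\<iota> a, \<iota> b) | a b. (a, b) \<in> R}" by blast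
    next
      fix w assume "w \<in> {(\<iota> a, \<iota> b) | a b. (a, b) \<in> R}"
      then obtain a b p where "w = (\<iota> a, \<iota> b)" "f p = (a, b)" "p \<in> space N"
        by (force simp: R)
      then have "w = (\<iota> (fst (f (\<pi> (\<kappa> p)))), \<iota> (snd (f (\<pi> (\<kappa> p)))))"
        by (simp add: inv)
      then show "w \<in> {(x, y). \<exists>z. (x, y, z) \<in> G}"
        by (auto simp: G_def)
    qed
    with rel have "link_rel T = {(\<iota> a, \<iota> b) | a b. (a, b) \<in> R}" by simp
    with T show thesis by (rule that)
  qed
qed

subsection \<open>Borel reconstruction from an isomorphic copy\<close>

lemma two_ops_hom_comp:
  "two_ops_hom f S T \<Longrightarrow> two_ops_hom g T U \<Longrightarrow> two_ops_hom (g \<circ> f) S U"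
  by (simp add: two_ops_hom_def)

lemma two_ops_hom_inv:
  assumes "bij h" "two_ops_hom h S T"
  shows "two_ops_hom (inv h) T S"
proof -
  have "inv h (f (h (inv h a)) (h (inv h b))) = inv h (f a b)" for f a b
    by (simp add: bij_is_surj[OF assms(1)] surj_f_inv_f)
  moreover have "inv h (h c) = c" for c
    by (simp add: bij_is_inj[OF assms(1)])
  ultimately show ?thesis
    using assms(2) unfolding two_ops_hom_def by metis
qed

lemma embeddability_transfer:
  assumes "bij f" "two_ops_hom f A S" "bij g" "two_ops_hom g B T"
  shows "(S, T) \<in> embeddability \<longleftrightarrow> (\<exists>h. inj h \<and> two_ops_hom h A B)"
proof
  assume "(S, T) \<in> embeddability"
  then obtain h where "inj h" "two_ops_hom h S T"
    by (auto simp: embeddability_def)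
  then have "inj (inv g \<circ> (h \<circ> f))" "two_ops_hom (inv g \<circ> (h \<circ> f)) A B"
    using assms by (auto intro!: inj_compose two_ops_hom_comp two_ops_hom_inv
        intro: bij_is_inj bij_imp_bij_inv)
  then show "\<exists>h. inj h \<and> two_ops_hom h A B" by blast
next
  assume "\<exists>h. inj h \<and> two_ops_hom h A B"
  then obtain h where "inj h" "two_ops_hom h A B" by blast
  then have "inj (g \<circ> (h \<circ> inv f))" "two_ops_hom (g \<circ> (h \<circ> inv f)) S T"
    using assms by (auto intro!: inj_compose two_ops_hom_comp two_ops_hom_inv
        intro: bij_is_inj bij_imp_bij_inv)
  then show "(S, T) \<in> embeddability"
    by (auto simp: embeddability_def)
qed

text \<open>The copy must have all of the natural numbers as its underlying set, so
  \<open>to_nat_on\<close> is taken as a bijection instead of the mere injection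
  \<open>to_nat\<close>.\<close>

definition elt_code :: "elt \<Rightarrow> nat" where
  "elt_code = to_nat_on UNIV"

lemma bij_elt_code: "bij elt_code"
proof -
  have "infinite (UNIV :: elt set)"
    by (rule infinite_super[OF subset_UNIV[of "range Fn"]]) (simp add: finite_image_iff inj_def)
  then show ?thesis
    unfolding elt_code_def by (intro to_nat_on_infinite) auto
qed

lemma inv_elt_code [simp]: "inv elt_code (elt_code e) = e"
  by (simp add: bij_elt_code bij_is_inj)

definition nat_monoid :: "tree3 \<Rightarrow> (nat \<Rightarrow> nat) \<Rightarrow> nat two_ops" where
  "nat_monoid T x = (\<lambda>_ _. elt_code Zero,
     \<lambda>a b. elt_code (star T x (inv elt_code a) (inv elt_code b)))"

lemma nat_monoid_LD: "LD_monoid (nat_monoid T x)"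
  by (simp add: LD_monoid_def nat_monoid_def)

lemma hom_elt_code: "two_ops_hom elt_code (path_monoid T x) (nat_monoid T x)"
  by (simp add: hom_path_monoid nat_monoid_def)

section \<open>Decoding an isomorphic copy from its operations\<close>

definition zero_of :: "nat two_ops \<Rightarrow> nat" where
  "zero_of S = fst S 0 0"

text \<open>In a copy, each \<open>LEAST\<close> picks the only number with the stated property. As
  a search through the natural numbers it depends on \<open>S\<close> in a Borel way.\<close>

primrec fn_of :: "nat two_ops \<Rightarrow> nat \<Rightarrow> nat" where
  "fn_of S 0 = (LEAST b. snd S b b \<noteq> zero_of S)"
| "fn_of S (Suc k) = (LEAST b. b \<noteq> fn_of S k \<and> snd S (fn_of S k) b \<noteq> zero_of S)"

abbreviation op_of :: "nat two_ops \<Rightarrow> fn \<Rightarrow> nat" where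
  "op_of S f \<equiv> fn_of S (to_nat f)"

definition one_of :: "nat two_ops \<Rightarrow> nat" where
  "one_of S = snd S (fn_of S 0) (fn_of S 0)"

primrec root_of :: "nat two_ops \<Rightarrow> nat \<Rightarrow> nat" where
  "root_of S 0 = (LEAST a. a \<noteq> zero_of S \<and> a \<noteq> one_of S \<and> (\<forall>k. a \<noteq> fn_of S k) \<and>
     snd S a (op_of S Trunc) = zero_of S \<and> (\<forall>c e. a \<noteq> snd S c (op_of S (Cons e))))"
| "root_of S (Suc n) = (LEAST a. snd S a (op_of S Trunc) = root_of S n)"

primrec el_of :: "nat two_ops \<Rightarrow> nat \<Rightarrow> link list \<Rightarrow> nat" where
  "el_of S n [] = root_of S n"
| "el_of S n (e # p) = snd S (el_of S n p) (op_of S (Cons e))"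

primrec decode :: "nat two_ops \<Rightarrow> elt \<Rightarrow> nat" where
  "decode S Zero = zero_of S"
| "decode S One = one_of S"
| "decode S (Fn k) = fn_of S k"
| "decode S (El n p) = el_of S n p"

text \<open>In a copy of the algebra of \<open>x\<close>, the root at level \<open>Suc n\<close>
  passes only the test for \<open>pre x (Suc n)\<close>, whose last entry is
  \<open>x n\<close>.\<close>

definition label_of :: "nat two_ops \<Rightarrow> nat \<Rightarrow> nat" where
  "label_of S n = (LEAST m. \<exists>u. length u = n \<and>
     snd S (root_of S (Suc n)) (op_of S (Test (u @ [m]))) \<noteq> zero_of S)"

lemma Least_eqI:
  fixes a :: nat
  assumes "\<And>b. P b \<longleftrightarrow> b = a"
  shows "(LEAST b. P b) = a"
  by (rule Least_equality) (simp_all add: assms)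

lemma Least_image_eqI:
  fixes h :: "'a \<Rightarrow> nat"
  assumes "bij h" "\<And>b. P (h b) \<longleftrightarrow> b = a"
  shows "(LEAST b. P b) = h a"
proof (rule Least_eqI)
  fix b
  obtain b' where "b = h b'"
    using assms(1) by (meson bij_pointE)
  then show "P b \<longleftrightarrow> b = h a"
    using assms(2)[of b'] inj_eq[OF bij_is_inj[OF assms(1)]] by simp
qed

text \<open>Truncation keeps the number of links, so an empty chain arises only from an empty
  chain.\<close>

lemma star_Trunc_eq_root_iff: "star T x a (op Trunc) = El n [] \<longleftrightarrow> a = El (Suc n) []"
proof (cases a)
  case (El m p)
  then show ?thesis
    by (cases m) (auto simp: truncate_def)
qed auto

text \<open>The first three conditions leave the elements \<open>El m p\<close>. Annihilation by
  \<open>Trunc\<close> then means \<open>m = 0\<close>, and not being a result of prepending means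
  \<open>p = []\<close>.\<close>

lemma root_iff:
  "a \<noteq> Zero \<and> a \<noteq> One \<and> (\<forall>k. a \<noteq> Fn k) \<and> star T x a (op Trunc) = Zero \<and>
    (\<forall>c e. a \<noteq> star T x c (op (Cons e))) \<longleftrightarrow> a = El 0 []"
proof (cases a)
  case (El m p)
  have "El 0 [] \<noteq> star T x c (op (Cons e))" for c e
    by (cases c) auto
  moreover have "p = []" if "\<forall>c e. El m p \<noteq> star T x c (op (Cons e))"
    using that[rule_format, of "El m (tl p)" "hd p"] by (cases p) simp_all
  ultimately show ?thesis
    using El by (cases m) auto
qed auto

text \<open>Each reconstructed constant has a characterization by products that \<open>h\<close>
  preserves, and prepending generates the rest. Both the isomorphism and the parameter
  \<open>x\<close> are thus functions of \<open>S\<close>.\<close>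

lemma decode_unique:
  assumes h: "bij h" and hom: "two_ops_hom h (path_monoid T x) S"
  shows "decode S = h" "label_of S = x"
proof -
  have eq: "h a = h b \<longleftrightarrow> a = b" for a b
    using inj_eq[OF bij_is_inj[OF h]] .
  have hZ: "fst S a b = h Zero" and hs: "snd S (h c) (h d) = h (star T x c d)" for a b c d
  proof -
    obtain a' b' where "a = h a'" "b = h b'"
      using h by (meson bij_pointE)
    then show "fst S a b = h Zero" "snd S (h c) (h d) = h (star T x c d)"
      using hom by (simp_all add: hom_path_monoid)
  qed
  have zero: "zero_of S = h Zero"
    by (simp add: zero_of_def hZ)
  have fn: "fn_of S k = h (Fn k)" for k
  proof (induction k)
    case 0
    show ?case
      unfolding fn_of.simps
      by (rule Least_image_eqI[OF h]) (simp add: hs zero eq star_square_nonzero_iff)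
  next
    case (Suc k)
    show ?case
      unfolding fn_of.simps
      by (rule Least_image_eqI[OF h]) (auto simp: hs zero eq star_Fn_nonzero_iff Suc)
  qed
  have one: "one_of S = h One"
    by (simp only: one_of_def fn hs) simp
  have root: "root_of S n = h (El n [])" for n
  proof (induction n)
    case 0
    \<comment> \<open>The quantifier over all numbers \<open>c\<close> becomes one over all elements
      because \<open>h\<close> is onto.\<close>
    have "(\<forall>c. h b \<noteq> snd S c (h d)) \<longleftrightarrow> (\<forall>c. b \<noteq> star T x c d)" for b d
      using h hs eq by (metis bij_pointE)
    then have img: "(\<forall>c e. h b \<noteq> snd S c (h (op (Cons e)))) \<longleftrightarrow> (\<forall>c e. b \<noteq> star T x c (op (Cons e)))" for b
      by blast
    show ?case
      unfolding root_of.simps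
      by (rule Least_image_eqI[OF h]) (simp only: hs zero eq one fn img root_iff)
  next
    case (Suc n)
    show ?case
      unfolding root_of.simps
      by (rule Least_image_eqI[OF h]) (simp only: hs eq fn Suc star_Trunc_eq_root_iff)
  qed
  have el: "el_of S n p = h (El n p)" for n p
    by (induction p) (simp_all add: root fn hs)
  have "decode S a = h a" for a
    by (cases a) (simp_all add: zero one fn el)
  then show "decode S = h" by blast
  show "label_of S = x"
  proof
    fix n
    have iff: "snd S (root_of S (Suc n)) (op_of S (Test v)) \<noteq> zero_of S \<longleftrightarrow> v = pre x (Suc n)" for v
      by (simp only: root fn hs zero eq) auto
    show "label_of S n = x n"
      unfolding label_of_def iff
      by (rule Least_eqI) (auto simp: pre_def)
  qed
qed

section \<open>Borel measurability of the algebras and of the decoding\<close>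

instance bool :: second_countable_topology
proof
  \<comment> \<open>Second countability allows Borel maps into the space of graphs to be recognized
    coordinatewise.\<close>
  show "\<exists>B :: bool set set. countable B \<and> open = generate_topology B"
    by (rule exI[of _ UNIV]) (auto simp: fun_eq_iff open_discrete intro: generate_topology.Basis)
qed

lemma pred_eq_countable:
  fixes f g :: "'a \<Rightarrow> 'b::countable"
  assumes [measurable]: "f \<in> M \<rightarrow>\<^sub>M count_space UNIV" "g \<in> M \<rightarrow>\<^sub>M count_space UNIV"
  shows "Measurable.pred M (\<lambda>x. f x = g x)"
proof -
  have "Measurable.pred M (\<lambda>x. \<exists>c. f x = c \<and> g x = c)"
    by measurable
  then show ?thesis by simp
qed

text \<open>For fixed \<open>a\<close> and \<open>b\<close> the product depends on \<open>x\<close>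
  only through a finite prefix.\<close>

lemma measurable_star:
  "(\<lambda>x. star T x a b) \<in> borel \<rightarrow>\<^sub>M count_space UNIV"
proof -
  have start: "(\<lambda>x. start x n p) \<in> borel \<rightarrow>\<^sub>M count_space UNIV" for n p
    by (cases p) simp_all
  have "Measurable.pred borel (\<lambda>x. T u (start x n p) w)" for u n p w
    by (rule measurable_compose[OF start]) simp
  then have chain: "Measurable.pred borel (\<lambda>x. chain T x n p)" for n p
    by (induction p) simp_all
  have "Measurable.pred borel (\<lambda>x. start x n p = u \<and> chain T x n p)" for n p u
    by (intro pred_intros_logic chain pred_eq_countable start) simp
  then have "(\<lambda>x. act T x k n p) \<in> borel \<rightarrow>\<^sub>M count_space UNIV" for k n p
    by (cases k) (simp_all add: act_def measurable_If)
  then show ?thesis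
    by (cases b; cases a) (simp_all add: star_def)
qed

lemma space_LD [simp]: "space LD_monoid_space = {S. LD_monoid S}"
  by (simp add: LD_monoid_space_def)

lemma measurable_op_graphs:
  "(\<lambda>S. op_graph (fst S)) \<in> LD_monoid_space \<rightarrow>\<^sub>M borel"
  "(\<lambda>S. op_graph (snd S)) \<in> LD_monoid_space \<rightarrow>\<^sub>M borel"
proof -
  have "(\<lambda>(comp, star). (op_graph comp, op_graph star)) \<in> LD_monoid_space \<rightarrow>\<^sub>M borel"
    unfolding LD_monoid_space_def by (rule measurable_vimage_algebra1) simp
  from measurable_compose[OF this borel_measurable_continuous_onI[OF continuous_on_fst[OF continuous_on_id]]]
    measurable_compose[OF this borel_measurable_continuous_onI[OF continuous_on_snd[OF continuous_on_id]]]
  show "(\<lambda>S. op_graph (fst S)) \<in> LD_monoid_space \<rightarrow>\<^sub>M borel"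
    "(\<lambda>S. op_graph (snd S)) \<in> LD_monoid_space \<rightarrow>\<^sub>M borel"
    by (simp_all add: case_prod_beta)
qed

lemma measurable_of_op_graph:
  assumes "(\<lambda>S. op_graph (F S)) \<in> M \<rightarrow>\<^sub>M borel"
  shows "(\<lambda>S. F S a b) \<in> M \<rightarrow>\<^sub>M count_space UNIV"
proof -
  have "(\<lambda>S. op_graph (F S) (a, b, c)) \<in> M \<rightarrow>\<^sub>M borel" for c
    by (rule measurable_product_then_coordinatewise[OF assms])
  then have "Measurable.pred M (\<lambda>S. F S a b = c)" for c
    by (simp add: op_graph_def measurable_cong_sets[OF refl sets_borel_eq_count_space])
  then have "(\<lambda>S. F S a b) -` {c} \<inter> space M \<in> sets M" for c
    by (simp add: pred_def vimage_def Collect_conj_eq[symmetric] Int_def conj_commute)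
  then show ?thesis
    by (simp add: measurable_count_space_eq2_countable)
qed

lemma op_graph_measurable:
  assumes [measurable]: "\<And>a b. (\<lambda>S. F S a b) \<in> M \<rightarrow>\<^sub>M count_space UNIV"
  shows "(\<lambda>S. op_graph (F S)) \<in> M \<rightarrow>\<^sub>M borel"
proof (rule measurable_coordinatewise_then_product)
  fix i :: "nat \<times> nat \<times> nat"
  obtain a b c where i: "i = (a, b, c)" by (cases i)
  have "Measurable.pred M (\<lambda>S. F S a b = c)"
    by measurable
  then show "(\<lambda>S. op_graph (F S) i) \<in> M \<rightarrow>\<^sub>M borel"
    by (simp add: i op_graph_def measurable_cong_sets[OF refl sets_borel_eq_count_space])
qed

lemma measurable_into_LD:
  assumes "\<And>x. x \<in> space M \<Longrightarrow> LD_monoid (F x)"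
    and "\<And>a b. (\<lambda>x. fst (F x) a b) \<in> M \<rightarrow>\<^sub>M count_space UNIV"
    and "\<And>a b. (\<lambda>x. snd (F x) a b) \<in> M \<rightarrow>\<^sub>M count_space UNIV"
  shows "F \<in> M \<rightarrow>\<^sub>M LD_monoid_space"
  unfolding LD_monoid_space_def
proof (rule measurable_vimage_algebra2)
  show "F \<in> space M \<rightarrow> {S. LD_monoid S}"
    using assms(1) by simp
  show "(\<lambda>x. case F x of (f, g) \<Rightarrow> (op_graph f, op_graph g)) \<in> M \<rightarrow>\<^sub>M borel"
    unfolding case_prod_beta
    by (intro borel_measurable_Pair op_graph_measurable assms)
qed

lemma measurable_nat_monoid:
  assumes "f \<in> M \<rightarrow>\<^sub>M borel"
  shows "(\<lambda>x. nat_monoid T (f x)) \<in> M \<rightarrow>\<^sub>M LD_monoid_space"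
proof (rule measurable_into_LD)
  show "(\<lambda>x. snd (nat_monoid T (f x)) a b) \<in> M \<rightarrow>\<^sub>M count_space UNIV" for a b
    unfolding nat_monoid_def snd_conv
    by (rule measurable_compose[OF measurable_compose[OF assms measurable_star]]) simp
qed (simp_all add: nat_monoid_LD, simp add: nat_monoid_def)

text \<open>The arguments may vary with \<open>S\<close> because they take only countably many
  values.\<close>

lemma measurable_fst_op [measurable (raw)]:
  assumes [measurable]: "f \<in> LD_monoid_space \<rightarrow>\<^sub>M count_space UNIV"
    "g \<in> LD_monoid_space \<rightarrow>\<^sub>M count_space UNIV"
  shows "(\<lambda>S. fst S (f S) (g S)) \<in> LD_monoid_space \<rightarrow>\<^sub>M count_space UNIV"
  by (intro measurable_compose_countable[OF measurable_compose_countable[OF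
        measurable_of_op_graph[OF measurable_op_graphs(1)]]] assms)

lemma measurable_snd_op [measurable (raw)]:
  assumes [measurable]: "f \<in> LD_monoid_space \<rightarrow>\<^sub>M count_space UNIV"
    "g \<in> LD_monoid_space \<rightarrow>\<^sub>M count_space UNIV"
  shows "(\<lambda>S. snd S (f S) (g S)) \<in> LD_monoid_space \<rightarrow>\<^sub>M count_space UNIV"
  by (intro measurable_compose_countable[OF measurable_compose_countable[OF
        measurable_of_op_graph[OF measurable_op_graphs(2)]]] assms)

declare pred_eq_countable [measurable (raw)]

lemma measurable_zero_of [measurable]: "zero_of \<in> LD_monoid_space \<rightarrow>\<^sub>M count_space UNIV"
  unfolding zero_of_def by measurable

lemma measurable_fn_of [measurable]: "(\<lambda>S. fn_of S k) \<in> LD_monoid_space \<rightarrow>\<^sub>M count_space UNIV"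
proof (induction k)
  case (Suc k)
  note [measurable] = Suc
  show ?case unfolding fn_of.simps by measurable
qed (unfold fn_of.simps, measurable)

lemma measurable_one_of [measurable]: "one_of \<in> LD_monoid_space \<rightarrow>\<^sub>M count_space UNIV"
  unfolding one_of_def by measurable

lemma measurable_root_of [measurable]: "(\<lambda>S. root_of S n) \<in> LD_monoid_space \<rightarrow>\<^sub>M count_space UNIV"
proof (induction n)
  case (Suc n)
  note [measurable] = Suc
  show ?case unfolding root_of.simps by measurable
qed (unfold root_of.simps, measurable)

lemma measurable_el_of [measurable]: "(\<lambda>S. el_of S n p) \<in> LD_monoid_space \<rightarrow>\<^sub>M count_space UNIV"
proof (induction p)
  case (Cons e p)
  note [measurable] = Cons
  show ?case unfolding el_of.simps by measurable
qed (unfold el_of.simps, measurable)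

lemma measurable_decode_elt: "(\<lambda>S. decode S a) \<in> LD_monoid_space \<rightarrow>\<^sub>M count_space UNIV"
  by (cases a) simp_all

lemma measurable_decode [measurable (raw)]:
  assumes "f \<in> LD_monoid_space \<rightarrow>\<^sub>M count_space UNIV"
  shows "(\<lambda>S. decode S (f S)) \<in> LD_monoid_space \<rightarrow>\<^sub>M count_space UNIV"
  by (rule measurable_compose_countable[OF measurable_decode_elt assms])

lemma measurable_label_of: "label_of \<in> LD_monoid_space \<rightarrow>\<^sub>M borel"
proof (rule measurable_into_baire)
  fix n
  show "(\<lambda>S. label_of S n) \<in> LD_monoid_space \<rightarrow>\<^sub>M count_space UNIV"
    unfolding label_of_def by measurable
qed

text \<open>The carrier is countable and the same for all \<open>x\<close>, so bijectivity and the
  homomorphism laws involve only countable quantifiers over Borel conditions.\<close>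

lemma pred_decode_iso:
  "Measurable.pred LD_monoid_space
     (\<lambda>S. bij (decode S) \<and> two_ops_hom (decode S) (path_monoid T (label_of S)) S)"
proof -
  note [measurable] = measurable_compose[OF measurable_label_of measurable_star]
  have "Measurable.pred LD_monoid_space
     (\<lambda>S. ((\<forall>a b. decode S a = decode S b \<longrightarrow> a = b) \<and> (\<forall>n. \<exists>a. decode S a = n)) \<and>
        (\<forall>a b. decode S Zero = fst S (decode S a) (decode S b)) \<and>
        (\<forall>a b. decode S (star T (label_of S) a b) = snd S (decode S a) (decode S b)))"
    by measurable
  then show ?thesis
    unfolding hom_path_monoid bij_def inj_def surj_def by (simp only: eq_commute)
qed

section \<open>The Borel class of isomorphic copies and the two reductions\<close>

definition copies :: "tree3 \<Rightarrow> (nat \<Rightarrow> nat) set \<Rightarrow> nat two_ops set" where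
  "copies T Y = {S. LD_monoid S \<and> label_of S \<in> Y \<and> bij (decode S) \<and>
     two_ops_hom (decode S) (path_monoid T (label_of S)) S}"

text \<open>Quantifying over isomorphisms shows closure under isomorphism but not Borelness; by
  \<open>decode_unique\<close> the quantifiers can be replaced by the explicit
  \<open>label_of S\<close> and \<open>decode S\<close>.\<close>

lemma copies_iff:
  assumes "LD_monoid S"
  shows "S \<in> copies T Y \<longleftrightarrow> (\<exists>x\<in>Y. \<exists>h. bij h \<and> two_ops_hom h (path_monoid T x) S)"
  using assms decode_unique unfolding copies_def by fastforce

lemma isomorphism_closed_copies: "isomorphism_closed (copies T Y)"
  unfolding isomorphism_closed_def
proof (intro ballI impI)
  fix S S' assume S: "S \<in> copies T Y" and S': "S' \<in> space LD_monoid_space" and iso: "isomorphic_ops S S'"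
  have "LD_monoid S" using S by (simp add: copies_def)
  then obtain x h where "x \<in> Y" "bij h" "two_ops_hom h (path_monoid T x) S"
    using S copies_iff by blast
  moreover obtain g where "bij g" "two_ops_hom g S S'"
    using iso by (auto simp: isomorphic_ops_def)
  ultimately have "bij (g \<circ> h)" "two_ops_hom (g \<circ> h) (path_monoid T x) S'"
    by (auto intro: bij_comp two_ops_hom_comp)
  with \<open>x \<in> Y\<close> S' show "S' \<in> copies T Y"
    by (subst copies_iff) auto
qed

lemma copies_measurable:
  assumes "Measurable.pred borel (\<lambda>x. x \<in> Y)"
  shows "copies T Y \<in> sets LD_monoid_space"
proof -
  have "Measurable.pred LD_monoid_space (\<lambda>S. label_of S \<in> Y \<and> bij (decode S) \<and>
      two_ops_hom (decode S) (path_monoid T (label_of S)) S)"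
    by (rule pred_intros_logic(3)[OF measurable_compose[OF measurable_label_of assms] pred_decode_iso])
  then show ?thesis
    by (simp add: pred_def copies_def)
qed

text \<open>The reductions are \<open>S \<mapsto> \<pi> (label_of S)\<close> and
  \<open>a \<mapsto> nat_monoid T (\<iota> a)\<close>. In both directions embeddability is
  transferred along isomorphisms to the algebras of chains, where it is
  \<open>link_rel T\<close>.\<close>

lemma restricted_bireducible:
  assumes len: "\<And>u v a. T u v a \<Longrightarrow> length u = length v \<and> length v = length a"
    and rel: "link_rel T = {(\<iota> a, \<iota> b) | a b. (a, b) \<in> R}"
    and R: "preorder_on (space X) R"
    and \<iota>: "\<iota> \<in> X \<rightarrow>\<^sub>M borel" and \<pi>: "\<pi> \<in> borel \<rightarrow>\<^sub>M X"
    and inv: "\<And>x. x \<in> space X \<Longrightarrow> \<pi> (\<iota> x) = x"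
  shows "borel_bireducible (restrict_space LD_monoid_space (copies T (\<iota> ` space X))) embeddability X R"
proof -
  let ?B = "copies T (\<iota> ` space X)"
  have R_space: "R \<subseteq> space X \<times> space X" and refl: "refl_on (space X) R" and "trans R"
    using R by (auto simp: preorder_on_def)
  have link: "(\<iota> a, \<iota> b) \<in> link_rel T \<longleftrightarrow> (a, b) \<in> R" if "a \<in> space X" "b \<in> space X" for a b
  proof
    assume "(\<iota> a, \<iota> b) \<in> link_rel T"
    then obtain a' b' where "\<iota> a = \<iota> a'" "\<iota> b = \<iota> b'" "(a', b') \<in> R"
      by (auto simp: rel)
    then show "(a, b) \<in> R"
      using R_space that inv by (metis SigmaD1 SigmaD2 subsetD)
  qed (auto simp: rel)
  have trans: "trans (link_rel T)"
  proof (rule transI)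
    fix x y z assume "(x, y) \<in> link_rel T" "(y, z) \<in> link_rel T"
    then obtain a b b' c where *: "x = \<iota> a" "y = \<iota> b" "(a, b) \<in> R" "y = \<iota> b'" "z = \<iota> c" "(b', c) \<in> R"
      by (auto simp: rel)
    then have "b = b'"
      using R_space inv by (metis SigmaD1 SigmaD2 subsetD)
    then have "(a, c) \<in> R"
      using * \<open>trans R\<close> by (meson transD)
    then show "(x, z) \<in> link_rel T"
      using * by (auto simp: rel)
  qed
  have emb: "(S, S') \<in> embeddability \<longleftrightarrow> (a, b) \<in> R"
    if "a \<in> space X" "b \<in> space X"
      "bij f" "two_ops_hom f (path_monoid T (\<iota> a)) S"
      "bij g" "two_ops_hom g (path_monoid T (\<iota> b)) S'" for S S' a b f g
  proof -
    have "(\<iota> a, \<iota> a) \<in> link_rel T"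
      using refl that(1) by (simp add: link refl_onD)
    then show ?thesis
      using embeddability_transfer[OF that(3-6)] embedding_iff_link_rel[of T "\<iota> a" "\<iota> b"] len trans
        link[OF that(1,2)] by blast
  qed
  \<comment> \<open>The label of a copy lies in the range of \<open>\<iota>\<close>, where
    \<open>\<iota> \<circ> \<pi>\<close> is the identity.\<close>
  have copy: "\<pi> (label_of S) \<in> space X \<and> bij (decode S) \<and>
      two_ops_hom (decode S) (path_monoid T (\<iota> (\<pi> (label_of S)))) S" if "S \<in> ?B" for S
    using that by (auto simp: copies_def inv)
  have "borel_reducible (restrict_space LD_monoid_space ?B) embeddability X R"
    unfolding borel_reducible_def
  proof (intro bexI ballI)
    show "(\<lambda>S. \<pi> (label_of S)) \<in> restrict_space LD_monoid_space ?B \<rightarrow>\<^sub>M X"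
      by (intro measurable_restrict_space1 measurable_compose[OF measurable_label_of \<pi>])
    fix S S'
    assume "S \<in> space (restrict_space LD_monoid_space ?B)" "S' \<in> space (restrict_space LD_monoid_space ?B)"
    then have "S \<in> ?B" "S' \<in> ?B"
      by (simp_all add: space_restrict_space)
    then show "(S, S') \<in> embeddability \<longleftrightarrow> (\<pi> (label_of S), \<pi> (label_of S')) \<in> R"
      using copy[of S] copy[of S'] emb by meson
  qed
  moreover have "borel_reducible X R (restrict_space LD_monoid_space ?B) embeddability"
    unfolding borel_reducible_def
  proof (intro bexI ballI)
    have "nat_monoid T (\<iota> x) \<in> ?B" if "x \<in> space X" for x
      using that copies_iff[OF nat_monoid_LD] bij_elt_code hom_elt_code by blast
    then show "(\<lambda>x. nat_monoid T (\<iota> x)) \<in> X \<rightarrow>\<^sub>M restrict_space LD_monoid_space ?B"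
      by (intro measurable_restrict_space2 measurable_nat_monoid \<iota>) simp
    show "(x, x') \<in> R \<longleftrightarrow> (nat_monoid T (\<iota> x), nat_monoid T (\<iota> x')) \<in> embeddability"
      if "x \<in> space X" "x' \<in> space X" for x x'
      using emb[OF that bij_elt_code hom_elt_code bij_elt_code hom_elt_code] by simp
  qed
  ultimately show ?thesis
    by (simp add: borel_bireducible_def)
qed

theorem theorem4p9:
  fixes X :: "'a measure" and R :: "'a rel"
  assumes "standard_borel X"
    and "analytic_quasi_order X R"
  shows "\<exists>B \<in> sets LD_monoid_space. isomorphism_closed B \<and>
           borel_bireducible (restrict_space LD_monoid_space B) embeddability X R"
proof (cases "space X = {}")
  case True
  have "space (restrict_space LD_monoid_space {}) = {}"
    by (simp add: space_restrict_space)
  then have "borel_bireducible (restrict_space LD_monoid_space {}) embeddability X R"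
    using True by (auto simp: borel_bireducible_def borel_reducible_def measurable_def)
  then show ?thesis
    by (intro bexI[of _ "{}"]) (simp_all add: isomorphism_closed_def)
next
  case False
  obtain \<iota> and \<pi> :: "(nat \<Rightarrow> nat) \<Rightarrow> 'a" where \<iota>: "\<iota> \<in> X \<rightarrow>\<^sub>M borel" and \<pi>: "\<pi> \<in> borel \<rightarrow>\<^sub>M X"
      and inv: "\<And>x. x \<in> space X \<Longrightarrow> \<pi> (\<iota> x) = x"
    by (rule standard_borel_coding[OF assms(1) False]) blast
  have R: "preorder_on (space X) R" "analytic_in (X \<Otimes>\<^sub>M X) R"
    using assms(2) by (simp_all add: analytic_quasi_order_def)
  obtain T where len: "\<And>u v a. T u v a \<Longrightarrow> length u = length v \<and> length v = length a"
      and rel: "link_rel T = {(\<iota> a, \<iota> b) | a b. (a, b) \<in> R}"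
    by (rule analytic_link_rel[OF R(2) \<iota>]) blast
  have "\<pi> z \<in> space X" for z
    using measurable_space[OF \<pi>] by simp
  \<comment> \<open>The range of the coding is the set of fixed points of
    \<open>\<iota> \<circ> \<pi>\<close>, which makes it Borel.\<close>
  then have "z \<in> \<iota> ` space X \<longleftrightarrow> \<iota> (\<pi> z) = z" for z
    by (auto simp: inv intro: image_eqI[OF sym])
  moreover have "Measurable.pred borel (\<lambda>z. \<iota> (\<pi> z) = z)"
    by (rule pred_eq_baire[OF measurable_compose[OF \<pi> \<iota>]]) simp
  ultimately have "copies T (\<iota> ` space X) \<in> sets LD_monoid_space"
    by (intro copies_measurable) simp
  then show ?thesis
    using isomorphism_closed_copies restricted_bireducible[OF len rel R(1) \<iota> \<pi> inv] by blast
qed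

end
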